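(* For each positive integer $n$ (in an infinite set of positive integers), let $G=G_n$ be a graph on $n$ vertices with maximum degree $\Delta(G)\le 3$, let $k=k(n)\le n$ be a positive integer with $k/n^{1/2}\to\infty$ as $n\to\infty$, and let $u_0=u_0(n)\in V(G)$ be such that $f(G,u_0,k)\to\infty$ as $n\to\infty$. Assign independently to each edge of $G$ a weight distributed according to the exponential distribution with rate $1$. Then, with probability tending to $1$ as $n\to\infty$, the following holds. (1) There exists a path of length $k$ in $G$ starting from $u_0$ with weight at least $$(1-o(1))\left(k+\frac{\log_2 f(G,u_0,k)}{2}\right).$$ (2) There exists a path of length $k$ in $G$ starting from $u_0$ with weight at most $$(1+o(1))\left(k-\frac{\log_2 f(G,u_0,k)}{2}\right).$$
   Context: The length of a path is the number of its vertices (not edges); a path has distinct vertices. For a graph $G$, a vertex $u_0\in V(G)$ and a positive integer $k$, $f(G,u_0,k)$ denotes the number of paths of length $k$ (i.e. with $k$ vertices) in $G$ starting from $u_0$. The weight of a path is the sum of the weights of its edges. Here $o(1)$ denotes a deterministic quantity tending to $0$ as $n\to\infty$; that is, the claim is that there is a deterministic sequence $\delta_n\to 0$ such that the statements with $1-o(1)$, $1+o(1)$ replaced by $1-\delta_n$, $1+\delta_n$ hold with probability tending to $1$. *)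

theory Defs
  imports "HOL-Probability.Probability"
begin

text \<open>
  A simple undirected graph is given by its vertex set and its edge set; an edge is the set of its
  two end-vertices.
\<close>

definition simple_graph :: "'v set \<Rightarrow> 'v set set \<Rightarrow> bool" where
  "simple_graph V E \<longleftrightarrow> finite V \<and> (\<forall>e\<in>E. e \<subseteq> V \<and> card e = 2)"

definition degree :: "'v set set \<Rightarrow> 'v \<Rightarrow> nat" where
  "degree E v = card {e \<in> E. v \<in> e}"

text \<open>Only meaningful for finite nonempty \<open>V\<close>.\<close>

definition max_degree :: "'v set \<Rightarrow> 'v set set \<Rightarrow> nat" where
  "max_degree V E = Max (degree E ` V)"

text \<open>The list of vertices of a path, in order, determines the path together with its start.\<close>

definition is_path :: "'v set \<Rightarrow> 'v set set \<Rightarrow> 'v list \<Rightarrow> bool" where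
  "is_path V E p \<longleftrightarrow>
     p \<noteq> [] \<and> set p \<subseteq> V \<and> distinct p \<and> successively (\<lambda>u v. {u, v} \<in> E) p"

text \<open>The length of a path counts its vertices, so it is \<open>length p\<close>.\<close>

definition paths_from :: "'v set \<Rightarrow> 'v set set \<Rightarrow> 'v \<Rightarrow> nat \<Rightarrow> 'v list set" where
  "paths_from V E u k = {p. is_path V E p \<and> hd p = u \<and> length p = k}"

definition num_paths :: "'v set \<Rightarrow> 'v set set \<Rightarrow> 'v \<Rightarrow> nat \<Rightarrow> nat" where
  "num_paths V E u k = card (paths_from V E u k)"

definition path_weight :: "('v set \<Rightarrow> real) \<Rightarrow> 'v list \<Rightarrow> real" where
  "path_weight w p = (\<Sum>i<length p - 1. w {p ! i, p ! Suc i})"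

text \<open>The filter for \<open>n\<close> tending to infinity through the set \<open>N\<close>.\<close>

definition at_top_in :: "nat set \<Rightarrow> nat filter" where
  "at_top_in N = inf sequentially (principal N)"

text \<open>
  \<open>W e\<close> is the random weight of the edge \<open>e\<close>; the weights of different edges are independent
  and exponentially distributed with rate 1.
\<close>

definition iid_exp_weights :: "'w measure \<Rightarrow> 'v set set \<Rightarrow> ('v set \<Rightarrow> 'w \<Rightarrow> real) \<Rightarrow> bool" where
  "iid_exp_weights M E W \<longleftrightarrow>
     prob_space M \<and>
     prob_space.indep_vars M (\<lambda>_. borel) W E \<and>
     (\<forall>e\<in>E. distributed M lborel (W e) (exponential_density 1))"

end

theory Submission
  imports Defs "HOL-Real_Asymp.Real_Asymp"
begin

text \<open>
  Write \<open>f\<close> for the number of admissible paths and, for a sign \<open>s = \<plusminus>1\<close>, let \<open>X p\<close> be the sum of the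
  centred weights \<open>s * (w e - 1)\<close> along \<open>p\<close>. Both claims follow if some path has
  \<open>X p \<ge> log 2 f / 2 - \<epsilon> k\<close>. Build the path edge by edge: the edges leading from the current vertex to
  unvisited vertices have not been looked at before, so their weights are fresh, and at a vertex with
  two extensions we compare them, giving the extension with \<open>m\<close> continuations the bonus
  \<open>log 2 m / 2\<close>. For two independent exponential variables the expected gain of this comparison is
  at least the loss of \<open>log 2 f / 2\<close>, by the inequality \<open>log 2 (1 + r) \<le> r powr (1 / (2 ln 2))\<close> on
  \<open>(0, 1]\<close>. As the gains have uniformly bounded exponential moments, induction on the length
  bounds the expected minimum over all paths of \<open>exp (- \<theta> * X p)\<close> by
  \<open>exp (C \<theta>\<^sup>2 k - \<theta> * log 2 f / 2)\<close>, up to a constant factor for the three extensions of the first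
  vertex. Markov's inequality with \<open>\<epsilon> = k powr (- 1 / 4)\<close> and \<open>\<theta>\<close> of order \<open>\<epsilon>\<close> concludes.
\<close>

subsection \<open>Paths and neighbours\<close>

text \<open>\<open>U\<close> stands for the vertices still available, the current vertex
  \<open>v\<close> included; along a path \<open>U\<close> shrinks while \<open>E\<close> stays
  fixed.\<close>

definition nbrs :: "'v set set \<Rightarrow> 'v set \<Rightarrow> 'v \<Rightarrow> 'v set" where
  "nbrs E U v = {x \<in> U - {v}. {v, x} \<in> E}"

lemma finite_paths_from: "finite U \<Longrightarrow> finite (paths_from U E v j)"
  by (rule finite_subset[of _ "{p. set p \<subseteq> U \<and> length p = j}"])
     (auto simp: paths_from_def is_path_def finite_lists_length_eq)

lemma paths_from_Suc_0: "v \<in> U \<Longrightarrow> paths_from U E v (Suc 0) = {[v]}"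
  by (auto simp: paths_from_def is_path_def length_Suc_conv)

text \<open>Dropping \<open>v\<close> from the available vertices encodes distinctness, so the tail
  of a path is again a path of the same kind. Both inductions on the length rest on this
  recursion.\<close>

lemma paths_from_Suc_Suc:
  assumes "v \<in> U"
  shows "paths_from U E v (Suc (Suc j)) =
    (\<Union>x\<in>nbrs E U v. (#) v ` paths_from (U - {v}) E x (Suc j))"
proof (intro equalityI subsetI)
  fix p assume p: "p \<in> paths_from U E v (Suc (Suc j))"
  then obtain x q where pq: "p = v # x # q"
    by (auto simp: paths_from_def length_Suc_conv)
  have "x \<in> nbrs E U v" "x # q \<in> paths_from (U - {v}) E x (Suc j)"
    using p by (auto simp: pq paths_from_def is_path_def nbrs_def)
  then show "p \<in> (\<Union>x\<in>nbrs E U v. (#) v ` paths_from (U - {v}) E x (Suc j))"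
    using pq by blast
next
  fix p assume "p \<in> (\<Union>x\<in>nbrs E U v. (#) v ` paths_from (U - {v}) E x (Suc j))"
  then obtain x q where x: "x \<in> nbrs E U v" and q: "q \<in> paths_from (U - {v}) E x (Suc j)"
    and p: "p = v # q" by auto
  then show "p \<in> paths_from U E v (Suc (Suc j))"
    using assms by (cases q) (auto simp: paths_from_def is_path_def nbrs_def)
qed

lemma num_paths_Suc_Suc:
  assumes "finite U" "v \<in> U"
  shows "num_paths U E v (Suc (Suc j)) = (\<Sum>x\<in>nbrs E U v. num_paths (U - {v}) E x (Suc j))"
proof -
  have "num_paths U E v (Suc (Suc j)) =
      (\<Sum>x\<in>nbrs E U v. card ((#) v ` paths_from (U - {v}) E x (Suc j)))"
    unfolding num_paths_def paths_from_Suc_Suc[OF assms(2)]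
    using assms(1)
    by (intro card_UN_disjoint) (auto simp: nbrs_def paths_from_def intro!: finite_imageI finite_paths_from[unfolded paths_from_def])
  then show ?thesis
    by (simp add: num_paths_def card_image)
qed

text \<open>The neighbour with the most continuations serves as the heavier branch in the induction
  and as the only branch followed at the root.\<close>

lemma max_nbr_num_paths:
  assumes "finite U" "v \<in> U" "0 < num_paths U E v (Suc (Suc j))"
  obtains y where "y \<in> nbrs E U v"
    "\<And>x. x \<in> nbrs E U v \<Longrightarrow> num_paths (U - {v}) E x (Suc j) \<le> num_paths (U - {v}) E y (Suc j)"
    "0 < num_paths (U - {v}) E y (Suc j)"
proof -
  let ?n = "\<lambda>x. num_paths (U - {v}) E x (Suc j)"
  have fin: "finite (nbrs E U v)" using assms(1) by (simp add: nbrs_def)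
  obtain x where x: "x \<in> nbrs E U v" "0 < ?n x"
    using assms(3) unfolding num_paths_Suc_Suc[OF assms(1,2)]
    by (metis gr0I less_numeral_extra(3) sum.not_neutral_contains_not_neutral)
  have "Max (?n ` nbrs E U v) \<in> ?n ` nbrs E U v" using fin x(1) by (intro Max_in) auto
  then obtain y where y: "y \<in> nbrs E U v" "?n y = Max (?n ` nbrs E U v)" by auto
  have max: "?n z \<le> ?n y" if "z \<in> nbrs E U v" for z
    unfolding y(2) using fin that by (intro Max_ge) auto
  show thesis using that[OF y(1) max] max[OF x(1)] x(2) by auto
qed

lemma num_paths_le_power:
  assumes "finite U" "v \<in> U" "\<And>x. x \<in> U \<Longrightarrow> card (nbrs E U x) \<le> d"
  shows "num_paths U E v (Suc j) \<le> d ^ j"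
  using assms
proof (induction j arbitrary: U v)
  case 0
  then show ?case by (simp add: num_paths_def paths_from_Suc_0)
next
  case (Suc j)
  have "num_paths (U - {v}) E x (Suc j) \<le> d ^ j" if "x \<in> nbrs E U v" for x
  proof (rule Suc.IH)
    fix y assume y: "y \<in> U - {v}"
    have "card (nbrs E (U - {v}) y) \<le> card (nbrs E U y)"
      using Suc.prems(1) by (intro card_mono) (auto simp: nbrs_def)
    then show "card (nbrs E (U - {v}) y) \<le> d" using Suc.prems(3)[of y] y by auto
  qed (use Suc.prems that in \<open>auto simp: nbrs_def\<close>)
  then have "num_paths U E v (Suc (Suc j)) \<le> card (nbrs E U v) * d ^ j"
    unfolding num_paths_Suc_Suc[OF Suc.prems(1,2)]
    using sum_bounded_above[of "nbrs E U v" "\<lambda>x. num_paths (U - {v}) E x (Suc j)" "d ^ j"] by simp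
  also have "\<dots> \<le> d * d ^ j"
    using Suc.prems(2,3) by (intro mult_right_mono) auto
  finally show ?case by simp
qed

text \<open>The walk has just left \<open>v\<close>, so one of the neighbours of \<open>x\<close> is
  used up. With degrees at most three, every branching after the first step is therefore at most
  binary.\<close>

lemma card_nbrs_Diff:
  assumes "finite U" "v \<in> U" "x \<in> nbrs E U v" "card (nbrs E U x) \<le> Suc d"
  shows "card (nbrs E (U - {v}) x) \<le> d"
proof -
  have "v \<in> nbrs E U x" using assms by (auto simp: nbrs_def insert_commute)
  moreover have "nbrs E (U - {v}) x = nbrs E U x - {v}" by (auto simp: nbrs_def)
  ultimately show ?thesis using assms by (simp add: card_Diff_singleton)
qed

lemma card_nbrs_le_degree:
  assumes "simple_graph V E"
  shows "card (nbrs E V v) \<le> degree E v"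
proof -
  have "finite E"
    using assms unfolding simple_graph_def by (auto intro: finite_subset[of _ "Pow V"])
  then show ?thesis
    unfolding degree_def
    by (intro card_inj_on_le[of "\<lambda>x. {v, x}"]) (auto simp: nbrs_def inj_on_def doubleton_eq_iff)
qed

section \<open>Path weights\<close>

lemma path_weight_Cons:
  assumes "q \<noteq> []"
  shows "path_weight w (v # q) = w {v, hd q} + path_weight w q"
proof -
  obtain n where n: "length q = Suc n" using assms by (cases q) auto
  show ?thesis
    unfolding path_weight_def
    using assms by (simp add: n sum.lessThan_Suc_shift hd_conv_nth del: sum.lessThan_Suc)
qed

text \<open>With \<open>s = - 1\<close> the search for a light path becomes the search for a heavy
  one. The subtracted term is the number of edges, one less than the number of vertices.\<close>

lemma path_weight_centered:
  "path_weight (\<lambda>e. s * (w e - 1)) p = s * (path_weight w p - real (length p - 1))"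
  by (simp add: path_weight_def sum_distrib_left[symmetric] sum_subtractf)

lemma path_edge:
  assumes "is_path U E p" "i < length p - 1"
  shows "{p ! i, p ! Suc i} \<in> E" "{p ! i, p ! Suc i} \<subseteq> U"
proof -
  show "{p ! i, p ! Suc i} \<in> E"
    using assms by (simp add: is_path_def successively_conv_nth)
  have "p ! i \<in> set p" "p ! Suc i \<in> set p" using assms(2) by auto
  then show "{p ! i, p ! Suc i} \<subseteq> U" using assms(1) by (auto simp: is_path_def)
qed

text \<open>Every edge of a path in \<open>U\<close> lies inside \<open>U\<close>; hence edges at a
  removed vertex cannot influence the continuation.\<close>

lemma path_weight_cong:
  assumes "is_path U E p" "\<And>e. e \<in> E \<Longrightarrow> e \<subseteq> U \<Longrightarrow> w e = w' e"
  shows "path_weight w p = path_weight w' p"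
  unfolding path_weight_def using path_edge[OF assms(1)] assms(2) by (intro sum.cong) auto

lemma path_weight_measurable:
  assumes "is_path U E p" "\<And>e. e \<in> E \<Longrightarrow> e \<subseteq> U \<Longrightarrow> (\<lambda>\<omega>. w \<omega> e) \<in> borel_measurable M"
  shows "(\<lambda>\<omega>. path_weight (w \<omega>) p) \<in> borel_measurable M"
  unfolding path_weight_def using path_edge[OF assms(1)] assms(2) by (intro borel_measurable_sum) auto

subsection \<open>Elementary inequalities\<close>

text \<open>The left-hand side is convex on \<open>{0..1}\<close>, with second derivative
  \<open>1 / (1 + r)\<close>, and the right-hand side is its chord between 0 and 1.\<close>

lemma xlogx_chord:
  fixes r :: real
  assumes "0 < r" "r \<le> 1"
  shows "(1 + r) * ln (1 + r) \<le> 2 * ln 2 * r"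
proof -
  have "convex_on {0..1} (\<lambda>r::real. (1 + r) * ln (1 + r))"
    by (rule f''_ge0_imp_convex[where f' = "\<lambda>r. ln (1 + r) + 1" and f'' = "\<lambda>r. 1 / (1 + r)"])
       (auto intro!: derivative_eq_intros simp: field_simps)
  from convex_onD[OF this, of r 0 1] assms show ?thesis by (simp add: mult.commute)
qed

text \<open>Both sides equal 1 at \<open>r = 1\<close> and have the same slope
  \<open>1 / (2 * ln 2)\<close> there, so no larger exponent would do.\<close>

lemma log2_le_powr:
  fixes r :: real
  assumes "0 < r" "r \<le> 1"
  shows "log 2 (1 + r) \<le> r powr (1 / (2 * ln 2))"
proof -
  \<comment> \<open>The logarithm \<open>h\<close> of the quotient of the two sides is decreasing by the chord bound.\<close>
  define h where "h x = ln x / (2 * ln 2) - ln (ln (1 + x))" for x :: real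
  have "h 1 \<le> h r"
  proof (rule DERIV_nonpos_imp_nonincreasing[of r 1 h])
    fix x assume x: "r \<le> x" "x \<le> 1"
    then have x0: "0 < x" "0 < ln (1 + x)" using assms by auto
    have "(h has_real_derivative 1 / x / (2 * ln 2) - 1 / (1 + x) / ln (1 + x)) (at x)"
      unfolding h_def using x0 by (auto intro!: derivative_eq_intros simp: mult_ac)
    moreover have "1 / x / (2 * ln 2) \<le> 1 / (1 + x) / ln (1 + x)"
      using xlogx_chord[of x] x x0 frac_le[of 1 1 "(1 + x) * ln (1 + x)" "2 * ln 2 * x"]
      by (simp add: mult_ac)
    ultimately show "\<exists>y. (h has_real_derivative y) (at x) \<and> y \<le> 0" by force
  qed (use assms in simp)
  then have "ln (ln (1 + r)) - ln (ln 2) \<le> ln r / (2 * ln 2)"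
    by (simp add: h_def)
  then have "exp (ln (ln (1 + r)) - ln (ln 2)) \<le> exp (ln r / (2 * ln 2))"
    by simp
  then show ?thesis using assms by (simp add: exp_diff powr_def log_def)
qed

text \<open>Taylor expansion of order two with the Lagrange remainder; the intermediate point
  \<open>t\<close> satisfies \<open>\<bar>t\<bar> \<le> \<bar>y\<bar>\<close>.\<close>

lemma exp_minus_le:
  fixes y :: real
  shows "exp (- y) \<le> 1 - y + y\<^sup>2 * exp \<bar>y\<bar>"
proof -
  obtain t where t: "\<bar>t\<bar> \<le> \<bar>- y\<bar>"
    and e: "exp (- y) = (\<Sum>m<2. (- y) ^ m / fact m) + exp t / fact 2 * (- y) ^ 2"
    using Maclaurin_exp_le[of "- y" 2] by blast
  have "exp t \<le> exp \<bar>y\<bar>" using t by simp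
  then have "exp t / 2 \<le> exp \<bar>y\<bar>" using exp_gt_zero[of t] by linarith
  then have "exp t / 2 * y\<^sup>2 \<le> exp \<bar>y\<bar> * y\<^sup>2" by (rule mult_right_mono) simp
  then show ?thesis using e by (simp add: numeral_2_eq_2 mult.commute)
qed

text \<open>Half of the exponent \<open>\<bar>x\<bar> / 4\<close> absorbs the square, the other half
  the factor with \<open>\<theta>\<close>. The bound is free of \<open>\<theta>\<close>, and its
  rate 1/4 is below the rate 1 of the weights, which keeps it integrable.\<close>

lemma square_mult_exp_le:
  fixes x \<theta> :: real
  assumes "0 \<le> \<theta>" "\<theta> \<le> 1/8"
  shows "x\<^sup>2 * exp (\<theta> * \<bar>x\<bar>) \<le> 128 * exp (\<bar>x\<bar> / 4)"
proof -
  \<comment> \<open>The quadratic term of the exponential series at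
    \<open>\<bar>x\<bar> / 8\<close>; clearing denominators gives
    \<open>128 = 2 * 8\<^sup>2\<close>.\<close>
  have "(\<bar>x\<bar> / 8)\<^sup>2 / 2 \<le> exp (\<bar>x\<bar> / 8)"
    using exp_lower_Taylor_quadratic[of "\<bar>x\<bar> / 8"] by auto
  then have 1: "x\<^sup>2 \<le> 128 * exp (\<bar>x\<bar> / 8)" by (simp add: power_divide)
  have 2: "exp (\<theta> * \<bar>x\<bar>) \<le> exp (\<bar>x\<bar> / 8)"
    using mult_right_mono[OF assms(2), of "\<bar>x\<bar>"] by simp
  have "x\<^sup>2 * exp (\<theta> * \<bar>x\<bar>) \<le> (128 * exp (\<bar>x\<bar> / 8)) * exp (\<bar>x\<bar> / 8)"
    using 1 2 by (intro mult_mono) auto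
  also have "\<dots> = 128 * exp (\<bar>x\<bar> / 4)" by (simp flip: exp_add)
  finally show ?thesis .
qed

subsection \<open>Comparing two exponential variables\<close>

definition exp_measure :: "real measure" where
  "exp_measure = density lborel (exponential_density 1)"

lemma sets_exp_measure [measurable_cong, simp]: "sets exp_measure = sets borel"
  by (simp add: exp_measure_def)

lemma space_exp_measure [simp]: "space exp_measure = UNIV"
  by (simp add: exp_measure_def)

interpretation exp_measure: prob_space exp_measure
  unfolding exp_measure_def by (rule prob_space_exponential_density) simp

lemma exp_measure_UNIV [simp]: "measure exp_measure UNIV = 1" "emeasure exp_measure UNIV = 1"
  using exp_measure.prob_space exp_measure.emeasure_space_1 by simp_all

interpretation exp_pair: pair_prob_space exp_measure exp_measure ..

abbreviation exp_pair :: "(real \<times> real) measure" where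
  "exp_pair \<equiv> exp_measure \<Otimes>\<^sub>M exp_measure"

lemma nn_integral_exp_measure:
  assumes [measurable]: "f \<in> borel_measurable borel"
  shows "(\<integral>\<^sup>+x. f x \<partial>exp_measure) = (\<integral>\<^sup>+x. ennreal (exp (- x)) * f x * indicator {0..} x \<partial>lborel)"
  unfolding exp_measure_def
  by (subst nn_integral_density)
     (auto simp: exponential_density_def intro!: nn_integral_cong split: split_indicator)

text \<open>\<open>ennreal\<close> sends negative reals to 0, so the integrand is the positive part
  of \<open>x - c\<close>. By lack of memory the value is the tail probability
  \<open>exp (- c)\<close> times the mean 1; the proof uses the antiderivative
  \<open>- ((x - c + 1) * exp (- x))\<close>.\<close>

lemma nn_integral_exp_measure_excess:
  assumes "0 \<le> c"
  shows "(\<integral>\<^sup>+x. ennreal (x - c) \<partial>exp_measure) = ennreal (exp (- c))"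
proof -
  have lim: "((\<lambda>x::real. - ((x - c + 1) * exp (- x))) \<longlongrightarrow> 0) at_top"
    by real_asymp
  have "(\<integral>\<^sup>+x. ennreal (x - c) \<partial>exp_measure) =
      (\<integral>\<^sup>+x. ennreal ((x - c) * exp (- x)) * indicator {c..} x \<partial>lborel)"
    using assms
    by (auto simp: nn_integral_exp_measure mult_ac ennreal_mult'[symmetric] ennreal_neg
        intro!: nn_integral_cong split: split_indicator)
  also have "\<dots> = ennreal (0 - - ((c - c + 1) * exp (- c)))"
    by (rule nn_integral_FTC_atLeast[OF _ _ _ lim])
       (auto intro!: derivative_eq_intros simp: algebra_simps mult_right_mono)
  finally show ?thesis by simp
qed

text \<open>Use the one-variable formula with threshold \<open>b + t\<close>, then integrate
  \<open>exp (- b) * exp (- (b + t))\<close> over \<open>b \<ge> 0\<close>.\<close>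

lemma nn_integral_exp_pair_excess:
  assumes "0 \<le> t"
  shows "(\<integral>\<^sup>+b. \<integral>\<^sup>+a. ennreal (a - b - t) \<partial>exp_measure \<partial>exp_measure) =
    ennreal (exp (- t) / 2)"
proof -
  have lim: "((\<lambda>x::real. - (exp (- 2 * x - t) / 2)) \<longlongrightarrow> 0) at_top"
    by real_asymp
  have "(\<integral>\<^sup>+b. \<integral>\<^sup>+a. ennreal (a - b - t) \<partial>exp_measure \<partial>exp_measure) =
      (\<integral>\<^sup>+b. ennreal (exp (- b)) * (\<integral>\<^sup>+a. ennreal (a - (b + t)) \<partial>exp_measure) *
        indicator {0..} b \<partial>lborel)"
    by (subst nn_integral_exp_measure) (auto simp: algebra_simps)
  also have "\<dots> = (\<integral>\<^sup>+b. ennreal (exp (- 2 * b - t)) * indicator {0..} b \<partial>lborel)"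
    using assms
    by (intro nn_integral_cong)
       (auto simp: nn_integral_exp_measure_excess ennreal_mult'[symmetric] simp flip: exp_add
             split: split_indicator)
  also have "\<dots> = ennreal (0 - - (exp (- 2 * 0 - t) / 2))"
    by (rule nn_integral_FTC_atLeast[OF _ _ _ lim])
       (auto intro!: derivative_eq_intros)
  finally show ?thesis by simp
qed

text \<open>This is the mean gain from switching to the second edge when it leads by more than
  \<open>t\<close>. The two signs differ in the roles of the coordinates, hence in the order of
  integration.\<close>

lemma exp_pair_excess:
  fixes s t :: real
  assumes s: "s = 1 \<or> s = - 1" and t: "0 \<le> t"
  shows "has_bochner_integral exp_pair (\<lambda>z. max 0 (s * (snd z - fst z) - t)) (exp (- t) / 2)"
proof -
  have "(\<integral>\<^sup>+z. ennreal (fst z - snd z - t) \<partial>exp_pair) = ennreal (exp (- t) / 2)"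
    by (subst exp_pair.nn_integral_snd[symmetric])
       (auto simp: nn_integral_exp_pair_excess[OF t])
  moreover have "(\<integral>\<^sup>+z. ennreal (snd z - fst z - t) \<partial>exp_pair) = ennreal (exp (- t) / 2)"
    by (subst exp_measure.nn_integral_fst[symmetric])
       (auto simp: nn_integral_exp_pair_excess[OF t])
  ultimately show ?thesis
    using s by (intro has_bochner_integral_nn_integral) auto
qed

lemma expectation_exp_measure: "has_bochner_integral exp_measure (\<lambda>x. x) 1"
proof -
  have "distributed exp_measure lborel (\<lambda>x. x) (exponential_density 1)"
    by (auto simp: distributed_def exp_measure_def intro!: distr_id2)
  then have "integral\<^sup>L exp_measure (\<lambda>x. x) = 1"
    using exp_measure.exponential_distributed_expectation[of 1 "\<lambda>x. x"] by simp
  \<comment> \<open>The Bochner integral of a non-integrable function is 0 by convention, so the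
    value 1 forces integrability.\<close>
  moreover from this have "integrable exp_measure (\<lambda>x. x)"
    using not_integrable_integral_eq by fastforce
  ultimately show ?thesis by (simp add: has_bochner_integral_iff)
qed

section \<open>Exponential moments of a single step\<close>

lemma exp_measure_quarter_moment:
  "(\<integral>\<^sup>+x. ennreal (exp (\<bar>x\<bar> / 4)) \<partial>exp_measure) = ennreal (4 / 3)"
proof -
  have lim: "((\<lambda>x::real. - (4 / 3 * exp (- (3 / 4) * x))) \<longlongrightarrow> 0) at_top"
    by real_asymp
  have "(\<integral>\<^sup>+x. ennreal (exp (\<bar>x\<bar> / 4)) \<partial>exp_measure) =
      (\<integral>\<^sup>+x. ennreal (exp (- (3 / 4) * x)) * indicator {0..} x \<partial>lborel)"
    by (subst nn_integral_exp_measure)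
       (auto simp: ennreal_mult'[symmetric] simp flip: exp_add
        intro!: nn_integral_cong split: split_indicator)
  also have "\<dots> = ennreal (0 - - (4 / 3 * exp (- (3 / 4) * 0)))"
    by (rule nn_integral_FTC_atLeast[OF _ _ _ lim])
       (auto intro!: derivative_eq_intros)
  finally show ?thesis by simp
qed

lemma expectation_exp_pair_fst:
  "has_bochner_integral exp_pair (\<lambda>z. s * (fst z - 1) - c) (- c)"
proof -
  have "has_bochner_integral exp_measure (\<lambda>x. s * (x - 1) - c) (- c)"
    using expectation_exp_measure by (simp add: has_bochner_integral_iff)
  then have "has_bochner_integral (distr exp_pair exp_measure fst) (\<lambda>x. s * (x - 1) - c) (- c)"
    by (subst exp_measure.distr_pair_fst)
  then show ?thesis
    by (simp add: has_bochner_integral_iff integrable_distr_eq integral_distr)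
qed

text \<open>The constant \<open>C\<close> of the outline. The integrand dominates the second-order
  remainder, up to the factor \<open>\<theta>\<^sup>2\<close>, of every gain bounded by
  \<open>\<bar>fst z\<bar> + \<bar>snd z\<bar> + 3\<close>, hence uniformly in the sign and in the
  numbers of continuations.\<close>

definition step_const :: real where
  "step_const = (\<integral>z. 128 * exp ((\<bar>fst z\<bar> + \<bar>snd z\<bar> + 3) / 4) \<partial>exp_pair)"

lemma integrable_step_const:
  "integrable exp_pair (\<lambda>z. 128 * exp ((\<bar>fst z\<bar> + \<bar>snd z\<bar> + 3) / 4))"
proof (rule integrableI_nonneg)
  have "(\<integral>\<^sup>+z. ennreal (128 * exp ((\<bar>fst z\<bar> + \<bar>snd z\<bar> + 3) / 4)) \<partial>exp_pair) =
    (\<integral>\<^sup>+x. \<integral>\<^sup>+y. ennreal (128 * exp (3 / 4)) * (ennreal (exp (\<bar>x\<bar> / 4)) * ennreal (exp (\<bar>y\<bar> / 4)))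
      \<partial>exp_measure \<partial>exp_measure)"
    by (subst exp_measure.nn_integral_fst[symmetric])
       (auto simp: ennreal_mult'[symmetric] add_divide_distrib exp_add mult_ac intro!: nn_integral_cong)
  also have "\<dots> = ennreal (128 * exp (3 / 4)) * (ennreal (4 / 3) * ennreal (4 / 3))"
    by (simp add: nn_integral_cmult nn_integral_multc exp_measure_quarter_moment)
  also have "\<dots> < \<infinity>"
    by (simp add: ennreal_mult_less_top)
  finally show "(\<integral>\<^sup>+z. ennreal (128 * exp ((\<bar>fst z\<bar> + \<bar>snd z\<bar> + 3) / 4)) \<partial>exp_pair) < \<infinity>" .
qed auto

lemma step_const_pos: "0 < step_const"
proof -
  have "(\<integral>z. 1 \<partial>exp_pair) \<le> step_const"
    unfolding step_const_def
  proof (intro integral_mono integrable_step_const)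
    fix z :: "real \<times> real"
    show "1 \<le> 128 * exp ((\<bar>fst z\<bar> + \<bar>snd z\<bar> + 3) / 4)"
      using exp_ge_add_one_self[of "(\<bar>fst z\<bar> + \<bar>snd z\<bar> + 3) / 4"]
      by (simp add: add_divide_distrib)
  qed simp
  then show ?thesis by (simp add: exp_pair.prob_space)
qed

text \<open>Integrate the second-order bound on the exponential: the linear term is harmless because
  the mean is nonnegative, and \<open>1 + x \<le> exp x\<close> turns the rest into a factor that
  multiplies along a path.\<close>

lemma exp_moment_le:
  assumes D [measurable]: "D \<in> borel_measurable exp_pair"
    and bound: "\<And>z. \<bar>D z\<bar> \<le> \<bar>fst z\<bar> + \<bar>snd z\<bar> + 3"
    and mean: "0 \<le> (\<integral>z. D z \<partial>exp_pair)"
    and \<theta>: "0 \<le> \<theta>" "\<theta> \<le> 1/8"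
  shows "(\<integral>\<^sup>+z. ennreal (exp (- \<theta> * D z)) \<partial>exp_pair) \<le> ennreal (exp (step_const * \<theta>\<^sup>2))"
proof -
  define H where "H z = 128 * exp ((\<bar>fst z\<bar> + \<bar>snd z\<bar> + 3) / 4)" for z :: "real \<times> real"
  have H: "integrable exp_pair H" unfolding H_def by (rule integrable_step_const)
  have "x \<le> 128 * exp (x / 4)" if "0 \<le> x" for x :: real
    using exp_ge_add_one_self[of "x / 4"] that by linarith
  then have D_H: "\<bar>D z\<bar> \<le> H z" for z
    unfolding H_def by (rule order_trans[OF bound]) simp
  have int_D: "integrable exp_pair D"
    by (rule Bochner_Integration.integrable_bound[OF H])
       (use D_H in \<open>auto intro!: order_trans[OF D_H]\<close>)
  have pointwise: "exp (- \<theta> * D z) \<le> 1 - \<theta> * D z + \<theta>\<^sup>2 * H z" for z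
  proof -
    have "(D z)\<^sup>2 * exp (\<theta> * \<bar>D z\<bar>) \<le> 128 * exp (\<bar>D z\<bar> / 4)"
      by (rule square_mult_exp_le[OF \<theta>])
    also have "\<dots> \<le> H z" using bound[of z] unfolding H_def by simp
    finally have "\<theta>\<^sup>2 * ((D z)\<^sup>2 * exp (\<theta> * \<bar>D z\<bar>)) \<le> \<theta>\<^sup>2 * H z"
      by (rule mult_left_mono) simp
    then show ?thesis
      using exp_minus_le[of "\<theta> * D z"] \<theta>
      by (simp add: power_mult_distrib abs_mult mult.assoc)
  qed
  have "(\<integral>\<^sup>+z. ennreal (exp (- \<theta> * D z)) \<partial>exp_pair) \<le>
      (\<integral>\<^sup>+z. ennreal (1 - \<theta> * D z + \<theta>\<^sup>2 * H z) \<partial>exp_pair)"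
    using pointwise by (intro nn_integral_mono ennreal_leI)
  also have "\<dots> = ennreal (\<integral>z. 1 - \<theta> * D z + \<theta>\<^sup>2 * H z \<partial>exp_pair)"
    using int_D H order_trans[OF exp_ge_zero pointwise]
    by (intro nn_integral_eq_integral) auto
  also have "(\<integral>z. 1 - \<theta> * D z + \<theta>\<^sup>2 * H z \<partial>exp_pair) =
      1 - \<theta> * (\<integral>z. D z \<partial>exp_pair) + step_const * \<theta>\<^sup>2"
    using int_D H by (simp add: exp_pair.prob_space step_const_def mult.commute flip: H_def)
  also have "ennreal \<dots> \<le> ennreal (exp (step_const * \<theta>\<^sup>2))"
    using exp_ge_add_one_self[of "step_const * \<theta>\<^sup>2"] mult_nonneg_nonneg[OF \<theta>(1) mean]
    by (intro ennreal_leI) linarith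
  finally show ?thesis .
qed

text \<open>Regarding the single weight as the first coordinate of a pair lets the same constant
  serve for both kinds of step.\<close>

lemma exp_moment_one_edge:
  fixes s \<theta> :: real
  assumes s: "s = 1 \<or> s = - 1" and \<theta>: "0 \<le> \<theta>" "\<theta> \<le> 1/8"
  shows "(\<integral>\<^sup>+x. ennreal (exp (- \<theta> * (s * (x - 1)))) \<partial>exp_measure) \<le> ennreal (exp (step_const * \<theta>\<^sup>2))"
proof -
  have "0 \<le> (\<integral>z. s * (fst z - 1) \<partial>exp_pair)"
    using has_bochner_integral_integral_eq[OF expectation_exp_pair_fst[of s 0]] by (simp del: integral_mult_right_zero)
  then have "(\<integral>\<^sup>+z. ennreal (exp (- \<theta> * (s * (fst z - 1)))) \<partial>exp_pair) \<le> ennreal (exp (step_const * \<theta>\<^sup>2))"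
    using s by (intro exp_moment_le \<theta>) auto
  also have "(\<integral>\<^sup>+z. ennreal (exp (- \<theta> * (s * (fst z - 1)))) \<partial>exp_pair) =
      (\<integral>\<^sup>+x. ennreal (exp (- \<theta> * (s * (x - 1)))) \<partial>exp_measure)"
    by (subst exp_measure.nn_integral_fst[symmetric]) auto
  finally show ?thesis .
qed

text \<open>
  With \<open>r = m / n\<close> and \<open>t = log 2 (n / m) / 2\<close>, the maximum exceeds \<open>log 2 (m + n) / 2\<close> in the mean by
  \<open>exp (- t) / 2 - log 2 (1 + r) / 2\<close>, and \<open>exp (- t) = r powr (1 / (2 * ln 2))\<close>.
\<close>

lemma exp_moment_two_edges:
  fixes s \<theta> m n :: real
  assumes s: "s = 1 \<or> s = - 1" and mn: "0 < m" "m \<le> n" and \<theta>: "0 \<le> \<theta>" "\<theta> \<le> 1/8"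
  shows "(\<integral>\<^sup>+z. ennreal (exp (- \<theta> * max (s * (fst z - 1) + log 2 n / 2) (s * (snd z - 1) + log 2 m / 2)))
      \<partial>exp_pair) \<le> ennreal (exp (step_const * \<theta>\<^sup>2 - \<theta> * (log 2 (m + n) / 2)))"
proof -
  define L where "L = log 2 (m + n) / 2"
  define t where "t = (log 2 n - log 2 m) / 2"
  define c where "c = L - log 2 n / 2"
  define D where "D z = max (s * (fst z - 1) + log 2 n / 2) (s * (snd z - 1) + log 2 m / 2) - L"
    for z :: "real \<times> real"
  \<comment> \<open>Follow the first edge by default; the last summand is the extra gain from
    switching to the second.\<close>
  have D: "D z = s * (fst z - 1) - c + max 0 (s * (snd z - fst z) - t)" for z
    unfolding D_def c_def t_def by (auto simp: max_def algebra_simps diff_divide_distrib)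
  have t0: "0 \<le> t" using mn by (simp add: t_def)
  have c0: "0 \<le> c" using mn by (simp add: c_def L_def)
  have "log 2 (m + n) \<le> log 2 (2 * n)" using mn by simp
  also have "\<dots> = 1 + log 2 n" using mn by (simp add: log_mult)
  finally have c1: "c \<le> 1 / 2" by (simp add: c_def L_def)
  have "log 2 (m + n) = log 2 (n * (1 + m / n))" using mn by (simp add: distrib_left add.commute)
  also have "\<dots> = log 2 n + log 2 (1 + m / n)" using mn by (subst log_mult) (auto simp: add_nonneg_eq_0_iff)
  finally have "c = log 2 (1 + m / n) / 2" unfolding c_def L_def by linarith
  also have "\<dots> \<le> (m / n) powr (1 / (2 * ln 2)) / 2"
    using log2_le_powr[of "m / n"] mn by simp
  also have "(m / n) powr (1 / (2 * ln 2)) = exp (- t)"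
    using mn by (simp add: powr_def t_def log_def ln_div field_simps)
  finally have c_t: "c \<le> exp (- t) / 2" .
  from has_bochner_integral_add[OF expectation_exp_pair_fst[of s c] exp_pair_excess[OF s t0]]
  have mean: "0 \<le> (\<integral>z. D z \<partial>exp_pair)"
    using c_t by (simp add: has_bochner_integral_iff D)
  \<comment> \<open>\<open>t\<close> may be arbitrarily large, but the second edge is taken only
    when it beats the first, which then gives the lower bound. \<open>c \<le> 1 / 2\<close> keeps
    the additive constant below 3.\<close>
  have "\<bar>D z\<bar> \<le> \<bar>fst z\<bar> + \<bar>snd z\<bar> + 3" for z
    using s t0 c0 c1 unfolding D by (auto simp: max_def)
  then have *: "(\<integral>\<^sup>+z. ennreal (exp (- \<theta> * D z)) \<partial>exp_pair) \<le> ennreal (exp (step_const * \<theta>\<^sup>2))"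
    by (intro exp_moment_le \<theta> mean) (auto simp: D_def)
  have "(\<integral>\<^sup>+z. ennreal (exp (- \<theta> * (D z + L))) \<partial>exp_pair) =
      (\<integral>\<^sup>+z. ennreal (exp (- \<theta> * D z)) * ennreal (exp (- \<theta> * L)) \<partial>exp_pair)"
    by (intro nn_integral_cong) (simp add: ennreal_mult'[symmetric] flip: exp_add, simp add: algebra_simps)
  also have "\<dots> = (\<integral>\<^sup>+z. ennreal (exp (- \<theta> * D z)) \<partial>exp_pair) * ennreal (exp (- \<theta> * L))"
    by (rule nn_integral_multc) (simp add: D_def)
  also have "\<dots> \<le> ennreal (exp (step_const * \<theta>\<^sup>2)) * ennreal (exp (- \<theta> * L))"
    by (rule mult_right_mono[OF *]) simp
  also have "\<dots> = ennreal (exp (step_const * \<theta>\<^sup>2 - \<theta> * L))"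
    by (simp add: ennreal_mult'[symmetric] flip: exp_add)
  finally show ?thesis by (simp add: D_def L_def)
qed

subsection \<open>Exponential moments of the best path\<close>

text \<open>The value is \<open>\<top>\<close> if there is no path.\<close>

definition best_cost ::
  "real \<Rightarrow> real \<Rightarrow> 'v set set \<Rightarrow> 'v set \<Rightarrow> 'v \<Rightarrow> nat \<Rightarrow> ('v set \<Rightarrow> real) \<Rightarrow> ennreal" where
  "best_cost s \<theta> E U v j w =
    (INF p\<in>paths_from U E v j. ennreal (exp (- \<theta> * path_weight (\<lambda>e. s * (w e - 1)) p)))"

lemma best_cost_measurable:
  assumes "finite U" "\<And>e. e \<in> E \<Longrightarrow> e \<subseteq> U \<Longrightarrow> e \<in> I"
  shows "best_cost s \<theta> E U v j \<in> borel_measurable (\<Pi>\<^sub>M e\<in>I. exp_measure)"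
  unfolding best_cost_def
proof (rule borel_measurable_INF)
  show "countable (paths_from U E v j)"
    by (rule countable_finite[OF finite_paths_from[OF assms(1)]])
next
  fix p assume "p \<in> paths_from U E v j"
  then have "is_path U E p" by (simp add: paths_from_def)
  then have "(\<lambda>w. path_weight (\<lambda>e. s * (w e - 1)) p) \<in> borel_measurable (\<Pi>\<^sub>M e\<in>I. exp_measure)"
    by (rule path_weight_measurable) (use assms(2) in measurable)
  then show "(\<lambda>w. ennreal (exp (- \<theta> * path_weight (\<lambda>e. s * (w e - 1)) p)))
      \<in> borel_measurable (\<Pi>\<^sub>M e\<in>I. exp_measure)"
    by measurable
qed

lemma best_cost_cong:
  assumes "\<And>e. e \<in> E \<Longrightarrow> e \<subseteq> U \<Longrightarrow> w e = w' e"
  shows "best_cost s \<theta> E U v j w = best_cost s \<theta> E U v j w'"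
  unfolding best_cost_def
  by (intro INF_cong refl arg_cong[where f = ennreal] arg_cong[where f = exp]
      arg_cong[where f = "\<lambda>x. - \<theta> * x"] path_weight_cong[of U E])
     (auto simp: paths_from_def assms)

text \<open>Go to \<open>x\<close> and continue along an optimal path; the infimum is attained
  because there are only finitely many paths.\<close>

lemma best_cost_le:
  assumes "finite U" "v \<in> U" "x \<in> nbrs E U v"
  shows "best_cost s \<theta> E U v (Suc (Suc j)) w \<le>
    ennreal (exp (- \<theta> * (s * (w {v, x} - 1)))) * best_cost s \<theta> E (U - {v}) x (Suc j) w"
proof (cases "paths_from (U - {v}) E x (Suc j) = {}")
  case True
  \<comment> \<open>The infimum over no paths is \<open>\<top>\<close>, and a positive factor times
    \<open>\<top>\<close> is \<open>\<top>\<close>, so the bound is trivial.\<close>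
  then show ?thesis by (simp add: best_cost_def ennreal_mult_top)
next
  case False
  let ?c = "\<lambda>p. ennreal (exp (- \<theta> * path_weight (\<lambda>e. s * (w e - 1)) p))"
  have "finite (?c ` paths_from (U - {v}) E x (Suc j))"
    using assms(1) by (intro finite_imageI finite_paths_from) auto
  then have "best_cost s \<theta> E (U - {v}) x (Suc j) w \<in> ?c ` paths_from (U - {v}) E x (Suc j)"
    unfolding best_cost_def using False Min_in by (subst cInf_eq_Min) auto
  then obtain q where q: "q \<in> paths_from (U - {v}) E x (Suc j)"
    and best: "best_cost s \<theta> E (U - {v}) x (Suc j) w = ?c q" by auto
  have "v # q \<in> paths_from U E v (Suc (Suc j))"
    unfolding paths_from_Suc_Suc[OF assms(2)] using assms(3) q by blast
  then have "best_cost s \<theta> E U v (Suc (Suc j)) w \<le> ?c (v # q)"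
    unfolding best_cost_def by (rule INF_lower)
  also have "q \<noteq> []" "hd q = x" using q by (auto simp: paths_from_def)
  then have "?c (v # q) = ennreal (exp (- \<theta> * (s * (w {v, x} - 1)))) * ?c q"
    by (simp add: path_weight_Cons ennreal_mult'[symmetric] distrib_left flip: exp_add)
  finally show ?thesis by (simp add: best)
qed

text \<open>Freshness of the edges at \<open>v\<close>: the continuation avoids \<open>v\<close>.
  Integrating such coordinates separately replaces any conditioning.\<close>

lemma best_cost_remove_vertex:
  assumes "v \<in> e"
  shows "best_cost s \<theta> E (U - {v}) x j (w(e := a)) = best_cost s \<theta> E (U - {v}) x j w"
  by (rule best_cost_cong) (use assms in auto)

section \<open>Averaging over the fresh edges\<close>

lemma product_sigma_finite_exp_measure: "product_sigma_finite (\<lambda>_. exp_measure)"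
  by (simp add: product_sigma_finite_def exp_measure.sigma_finite_measure_axioms)

text \<open>The continuation does not see the weight of \<open>{v, x}\<close>, so after splitting
  off this coordinate the integral factorises.\<close>

lemma nn_integral_best_cost_single:
  assumes fin: "finite U" "finite I" and I: "\<And>e. e \<in> E \<Longrightarrow> e \<subseteq> U \<Longrightarrow> e \<in> I"
    and v: "v \<in> U" and x: "x \<in> nbrs E U v"
    and s: "s = 1 \<or> s = - 1" and \<theta>: "0 \<le> \<theta>" "\<theta> \<le> 1/8"
    and B: "(\<integral>\<^sup>+w. best_cost s \<theta> E (U - {v}) x (Suc j) w \<partial>(\<Pi>\<^sub>M e\<in>I - {{v, x}}. exp_measure)) \<le> B"
  shows "(\<integral>\<^sup>+w. best_cost s \<theta> E U v (Suc (Suc j)) w \<partial>(\<Pi>\<^sub>M e\<in>I. exp_measure))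
    \<le> ennreal (exp (step_const * \<theta>\<^sup>2)) * B"
proof -
  interpret product_sigma_finite "\<lambda>_::'a set. exp_measure" by (rule product_sigma_finite_exp_measure)
  define J where "J = I - {{v, x}}"
  let ?P = "\<lambda>I. (\<Pi>\<^sub>M e\<in>I. exp_measure)"
  have IJ: "I = insert {v, x} J" and J: "{v, x} \<notin> J" "finite J"
    using x v I[of "{v, x}"] fin unfolding J_def by (auto simp: nbrs_def)
  have meas: "best_cost s \<theta> E (U - {v}) x (Suc j) \<in> borel_measurable (?P J)"
    using fin I by (intro best_cost_measurable) (auto simp: J_def)
  have "(\<integral>\<^sup>+w. best_cost s \<theta> E U v (Suc (Suc j)) w \<partial>?P I) =
      (\<integral>\<^sup>+a. \<integral>\<^sup>+w. best_cost s \<theta> E U v (Suc (Suc j)) (w({v, x} := a)) \<partial>?P J \<partial>exp_measure)"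
    unfolding IJ using I
    by (intro product_nn_integral_insert_rev J best_cost_measurable[OF fin(1)]) (simp flip: IJ)
  also have "\<dots> \<le> (\<integral>\<^sup>+a. ennreal (exp (- \<theta> * (s * (a - 1)))) * B \<partial>exp_measure)"
  proof (rule nn_integral_mono)
    fix a
    have "(\<integral>\<^sup>+w. best_cost s \<theta> E U v (Suc (Suc j)) (w({v, x} := a)) \<partial>?P J) \<le>
        (\<integral>\<^sup>+w. ennreal (exp (- \<theta> * (s * (a - 1)))) * best_cost s \<theta> E (U - {v}) x (Suc j) w \<partial>?P J)"
      using best_cost_le[OF fin(1) v x, of s \<theta> j "_({v, x} := a)"]
      by (intro nn_integral_mono) (simp add: best_cost_remove_vertex)
    also have "\<dots> = ennreal (exp (- \<theta> * (s * (a - 1)))) * (\<integral>\<^sup>+w. best_cost s \<theta> E (U - {v}) x (Suc j) w \<partial>?P J)"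
      by (rule nn_integral_cmult[OF meas])
    also have "\<dots> \<le> ennreal (exp (- \<theta> * (s * (a - 1)))) * B"
      using B unfolding J_def by (rule mult_left_mono) simp
    finally show "(\<integral>\<^sup>+w. best_cost s \<theta> E U v (Suc (Suc j)) (w({v, x} := a)) \<partial>?P J) \<le>
        ennreal (exp (- \<theta> * (s * (a - 1)))) * B" .
  qed
  also have "\<dots> = (\<integral>\<^sup>+a. ennreal (exp (- \<theta> * (s * (a - 1)))) \<partial>exp_measure) * B"
    by (rule nn_integral_multc) simp
  also have "\<dots> \<le> ennreal (exp (step_const * \<theta>\<^sup>2)) * B"
    by (intro mult_right_mono exp_moment_one_edge s \<theta>) simp
  finally show ?thesis .
qed

text \<open>For fixed weights \<open>a\<close> of \<open>{v, y}\<close> and \<open>b\<close> of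
  \<open>{v, x}\<close>, each branch bounds the expected cost over the remaining edges, so the
  branch may be chosen from \<open>a\<close>, \<open>b\<close> and the bonuses alone. This puts the
  maximum of the two-edge estimate into the exponent.\<close>

lemma nn_integral_best_cost_double:
  fixes m n K :: real
  assumes fin: "finite U" "finite I" and I: "\<And>e. e \<in> E \<Longrightarrow> e \<subseteq> U \<Longrightarrow> e \<in> I"
    and v: "v \<in> U" and x: "x \<in> nbrs E U v" and y: "y \<in> nbrs E U v" and xy: "x \<noteq> y"
    and s: "s = 1 \<or> s = - 1" and \<theta>: "0 \<le> \<theta>" "\<theta> \<le> 1/8" and mn: "0 < m" "m \<le> n"
    and Bx: "(\<integral>\<^sup>+w. best_cost s \<theta> E (U - {v}) x (Suc j) w \<partial>(\<Pi>\<^sub>M e\<in>I - {{v, x}, {v, y}}. exp_measure))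
      \<le> ennreal (exp (K - \<theta> * (log 2 m / 2)))"
    and By: "(\<integral>\<^sup>+w. best_cost s \<theta> E (U - {v}) y (Suc j) w \<partial>(\<Pi>\<^sub>M e\<in>I - {{v, x}, {v, y}}. exp_measure))
      \<le> ennreal (exp (K - \<theta> * (log 2 n / 2)))"
  shows "(\<integral>\<^sup>+w. best_cost s \<theta> E U v (Suc (Suc j)) w \<partial>(\<Pi>\<^sub>M e\<in>I. exp_measure))
    \<le> ennreal (exp (step_const * \<theta>\<^sup>2 + K - \<theta> * (log 2 (m + n) / 2)))"
proof -
  interpret product_sigma_finite "\<lambda>_::'a set. exp_measure" by (rule product_sigma_finite_exp_measure)
  define J where "J = I - {{v, x}, {v, y}}"
  let ?P = "\<lambda>I. (\<Pi>\<^sub>M e\<in>I. exp_measure)"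
  let ?f = "best_cost s \<theta> E U v (Suc (Suc j))"
  let ?M = "\<lambda>a b. max (s * (a - 1) + log 2 n / 2) (s * (b - 1) + log 2 m / 2)"
  have ne: "{v, x} \<noteq> {v, y}" using xy by (auto simp: doubleton_eq_iff)
  have IJ: "I = insert {v, y} (insert {v, x} J)"
    and J: "{v, x} \<notin> J" "{v, y} \<notin> insert {v, x} J" "finite J"
    using x y v ne I[of "{v, x}"] I[of "{v, y}"] fin unfolding J_def by (auto simp: nbrs_def)
  have meas: "best_cost s \<theta> E (U - {v}) z (Suc j) \<in> borel_measurable (?P J)" for z
    using fin I by (intro best_cost_measurable) (auto simp: J_def)
  have meas_f: "?f \<in> borel_measurable (?P (insert {v, y} (insert {v, x} J)))"
    using I by (intro best_cost_measurable[OF fin(1)]) (simp flip: IJ)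
  \<comment> \<open>Commit to the branch through \<open>z\<close>, whose edge carries the fixed
    weight \<open>c\<close>; this covers \<open>z = x\<close> and \<open>z = y\<close> at
    once.\<close>
  have bound: "(\<integral>\<^sup>+w. ?f (w({v, x} := b, {v, y} := a)) \<partial>?P J) \<le> ennreal (exp (K - \<theta> * (s * (c - 1) + log 2 l / 2)))"
    if z: "z \<in> nbrs E U v" and c: "\<And>w. (w({v, x} := b, {v, y} := a)) {v, z} = c"
      and B: "(\<integral>\<^sup>+w. best_cost s \<theta> E (U - {v}) z (Suc j) w \<partial>?P J) \<le> ennreal (exp (K - \<theta> * (log 2 l / 2)))"
    for a b c l z
  proof -
    have "(\<integral>\<^sup>+w. ?f (w({v, x} := b, {v, y} := a)) \<partial>?P J) \<le>
        (\<integral>\<^sup>+w. ennreal (exp (- \<theta> * (s * (c - 1)))) * best_cost s \<theta> E (U - {v}) z (Suc j) w \<partial>?P J)"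
    proof (rule nn_integral_mono)
      fix w
      show "?f (w({v, x} := b, {v, y} := a)) \<le>
          ennreal (exp (- \<theta> * (s * (c - 1)))) * best_cost s \<theta> E (U - {v}) z (Suc j) w"
        using best_cost_le[OF fin(1) v z, of s \<theta> j "w({v, x} := b, {v, y} := a)"]
        unfolding c by (simp add: best_cost_remove_vertex)
    qed
    also have "\<dots> = ennreal (exp (- \<theta> * (s * (c - 1)))) * (\<integral>\<^sup>+w. best_cost s \<theta> E (U - {v}) z (Suc j) w \<partial>?P J)"
      by (rule nn_integral_cmult[OF meas])
    also have "\<dots> \<le> ennreal (exp (- \<theta> * (s * (c - 1)))) * ennreal (exp (K - \<theta> * (log 2 l / 2)))"
      by (rule mult_left_mono[OF B]) simp
    also have "\<dots> = ennreal (exp (K - \<theta> * (s * (c - 1) + log 2 l / 2)))"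
      by (simp add: ennreal_mult'[symmetric] distrib_left flip: exp_add)
    finally show ?thesis .
  qed
  have "(\<integral>\<^sup>+w. ?f w \<partial>?P I) =
      (\<integral>\<^sup>+a. \<integral>\<^sup>+w. ?f (w({v, y} := a)) \<partial>?P (insert {v, x} J) \<partial>exp_measure)"
    unfolding IJ by (intro product_nn_integral_insert_rev J meas_f) (use J in auto)
  also have "\<dots> = (\<integral>\<^sup>+a. \<integral>\<^sup>+b. \<integral>\<^sup>+w. ?f (w({v, x} := b, {v, y} := a)) \<partial>?P J \<partial>exp_measure \<partial>exp_measure)"
  proof (rule nn_integral_cong)
    fix a
    have "(\<lambda>w. w({v, y} := a)) \<in> ?P (insert {v, x} J) \<rightarrow>\<^sub>M ?P (insert {v, y} (insert {v, x} J))"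
      by (rule measurable_fun_upd[where J = "insert {v, x} J"]) auto
    from measurable_compose[OF this meas_f]
    show "(\<integral>\<^sup>+w. ?f (w({v, y} := a)) \<partial>?P (insert {v, x} J)) =
        (\<integral>\<^sup>+b. \<integral>\<^sup>+w. ?f (w({v, x} := b, {v, y} := a)) \<partial>?P J \<partial>exp_measure)"
      by (intro product_nn_integral_insert_rev J)
  qed
  also have "\<dots> \<le> (\<integral>\<^sup>+a. \<integral>\<^sup>+b. ennreal (exp K) * ennreal (exp (- \<theta> * ?M a b)) \<partial>exp_measure \<partial>exp_measure)"
  proof (intro nn_integral_mono)
    fix a b
    have "(\<integral>\<^sup>+w. ?f (w({v, x} := b, {v, y} := a)) \<partial>?P J) \<le> ennreal (exp (K - \<theta> * ?M a b))"
      using bound[OF x, of b a b m] bound[OF y, of b a a n] Bx By ne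
      unfolding J_def by (auto simp: max_def)
    then show "(\<integral>\<^sup>+w. ?f (w({v, x} := b, {v, y} := a)) \<partial>?P J) \<le> ennreal (exp K) * ennreal (exp (- \<theta> * ?M a b))"
      by (simp add: ennreal_mult'[symmetric] flip: exp_add)
  qed
  also have "\<dots> = ennreal (exp K) * (\<integral>\<^sup>+z. ennreal (exp (- \<theta> * ?M (fst z) (snd z))) \<partial>exp_pair)"
    by (subst exp_measure.nn_integral_fst[symmetric]) (auto simp: nn_integral_cmult)
  also have "\<dots> \<le> ennreal (exp K) * ennreal (exp (step_const * \<theta>\<^sup>2 - \<theta> * (log 2 (m + n) / 2)))"
    by (intro mult_left_mono exp_moment_two_edges s mn \<theta>) simp
  also have "\<dots> = ennreal (exp (step_const * \<theta>\<^sup>2 + K - \<theta> * (log 2 (m + n) / 2)))"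
    by (simp add: ennreal_mult'[symmetric] algebra_simps flip: exp_add)
  finally show ?thesis .
qed

lemma nn_integral_best_cost_Suc_0:
  "v \<in> U \<Longrightarrow> (\<integral>\<^sup>+w. best_cost s \<theta> E U v (Suc 0) w \<partial>(\<Pi>\<^sub>M e\<in>I. exp_measure)) = 1"
  using prob_space.emeasure_space_1[OF prob_space_PiM[of I "\<lambda>_. exp_measure"]] exp_measure.prob_space_axioms
  by (simp add: best_cost_def paths_from_Suc_0 path_weight_def)

text \<open>Induction over all \<open>U\<close>, \<open>I\<close> and \<open>v\<close>. The index
  set \<open>I\<close> need only contain the edges inside \<open>U\<close>, since a step deletes
  just the one or two edges examined. The bound 2 on the neighbours of the start reproduces itself
  by \<open>card_nbrs_Diff\<close>.\<close>

lemma nn_integral_best_cost: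
  assumes "finite U" "finite I" "\<And>e. e \<in> E \<Longrightarrow> e \<subseteq> U \<Longrightarrow> e \<in> I"
    and "v \<in> U" "card (nbrs E U v) \<le> 2" "\<And>x. x \<in> U \<Longrightarrow> card (nbrs E U x) \<le> 3"
    and s: "s = 1 \<or> s = - 1" and \<theta>: "0 \<le> \<theta>" "\<theta> \<le> 1/8"
    and "0 < num_paths U E v (Suc j)"
  shows "(\<integral>\<^sup>+w. best_cost s \<theta> E U v (Suc j) w \<partial>(\<Pi>\<^sub>M e\<in>I. exp_measure))
    \<le> ennreal (exp (real j * (step_const * \<theta>\<^sup>2) - \<theta> * (log 2 (num_paths U E v (Suc j)) / 2)))"
  using assms(1-6,10)
proof (induction j arbitrary: U I v)
  case 0
  then show ?case
    by (subst nn_integral_best_cost_Suc_0) (auto simp: num_paths_def paths_from_Suc_0)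
next
  case (Suc j)
  let ?n = "\<lambda>x. num_paths (U - {v}) E x (Suc j)"
  let ?B = "\<lambda>x. exp (real j * (step_const * \<theta>\<^sup>2) - \<theta> * (log 2 (?n x) / 2))"
  have F: "num_paths U E v (Suc (Suc j)) = (\<Sum>x\<in>nbrs E U v. ?n x)"
    by (rule num_paths_Suc_Suc) fact+
  have fin: "finite (nbrs E U v)" using Suc.prems(1) by (simp add: nbrs_def)
  have IH: "(\<integral>\<^sup>+w. best_cost s \<theta> E (U - {v}) x (Suc j) w \<partial>(\<Pi>\<^sub>M e\<in>J. exp_measure)) \<le> ennreal (?B x)"
    if x: "x \<in> nbrs E U v" and "0 < ?n x" and J: "finite J" "\<And>e. e \<in> E \<Longrightarrow> e \<subseteq> U - {v} \<Longrightarrow> e \<in> J" for x J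
  proof (rule Suc.IH)
    have nb: "x' \<in> U" if "x' \<in> nbrs E U v" for x' using that by (simp add: nbrs_def)
    show "card (nbrs E (U - {v}) x) \<le> 2"
      using Suc.prems(1,4) x Suc.prems(6)[OF nb[OF x]] by (intro card_nbrs_Diff) auto
    show "card (nbrs E (U - {v}) y) \<le> 3" if "y \<in> U - {v}" for y
    proof -
      have "card (nbrs E (U - {v}) y) \<le> card (nbrs E U y)"
        using Suc.prems(1) by (intro card_mono) (auto simp: nbrs_def)
      then show ?thesis using Suc.prems(6)[of y] that by auto
    qed
  qed (use Suc.prems(1) x that in \<open>auto simp: nbrs_def\<close>)
  obtain y where y: "y \<in> nbrs E U v" and max: "\<And>x. x \<in> nbrs E U v \<Longrightarrow> ?n x \<le> ?n y"
    and ny: "0 < ?n y"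
    using max_nbr_num_paths[OF Suc.prems(1,4,7)] by blast
  show ?case
  proof (cases "\<exists>x\<in>nbrs E U v. x \<noteq> y \<and> 0 < ?n x")
    \<comment> \<open>Any other neighbour has no continuation and leaves the count unchanged, so one
      edge is followed without a comparison.\<close>
    case False
    then have "(\<Sum>x\<in>nbrs E U v. ?n x) = (\<Sum>x\<in>{y}. ?n x)"
      using y fin by (intro sum.mono_neutral_right) auto
    then have F': "num_paths U E v (Suc (Suc j)) = ?n y" using F by simp
    have "(\<integral>\<^sup>+w. best_cost s \<theta> E U v (Suc (Suc j)) w \<partial>(\<Pi>\<^sub>M e\<in>I. exp_measure)) \<le>
        ennreal (exp (step_const * \<theta>\<^sup>2)) * ennreal (?B y)"
      using Suc.prems(2,3)
      by (intro nn_integral_best_cost_single[OF Suc.prems(1-4) y s \<theta>] IH[OF y ny]) auto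
    then show ?thesis
      by (simp add: F' ennreal_mult'[symmetric] algebra_simps flip: exp_add)
  next
    case True
    then obtain x where x: "x \<in> nbrs E U v" "x \<noteq> y" "0 < ?n x" by blast
    \<comment> \<open>The bound 2 leaves no room for a third branch, so the count is a sum of two
      terms, as the two-edge estimate requires.\<close>
    have "nbrs E U v = {x, y}"
      using card_seteq[of "nbrs E U v" "{x, y}"] fin x(1,2) y Suc.prems(5) by auto
    then have F': "num_paths U E v (Suc (Suc j)) = ?n x + ?n y" using F x(2) by simp
    have "(\<integral>\<^sup>+w. best_cost s \<theta> E U v (Suc (Suc j)) w \<partial>(\<Pi>\<^sub>M e\<in>I. exp_measure)) \<le>
        ennreal (exp (step_const * \<theta>\<^sup>2 + real j * (step_const * \<theta>\<^sup>2) - \<theta> * (log 2 (real (?n x) + real (?n y)) / 2)))"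
      using Suc.prems(2,3) x max
      by (intro nn_integral_best_cost_double[OF Suc.prems(1-4) x(1) y x(2) s \<theta>] IH x y ny) auto
    then show ?thesis by (simp add: F' algebra_simps)
  qed
qed

text \<open>The first vertex may have three neighbours. Following only the one with the most
  continuations keeps at least a third of the paths and costs a bounded factor.\<close>

lemma nn_integral_best_cost_root:
  assumes "finite U" "finite I" "\<And>e. e \<in> E \<Longrightarrow> e \<subseteq> U \<Longrightarrow> e \<in> I"
    and "v \<in> U" and deg: "\<And>x. x \<in> U \<Longrightarrow> card (nbrs E U x) \<le> 3"
    and s: "s = 1 \<or> s = - 1" and \<theta>: "0 \<le> \<theta>" "\<theta> \<le> 1/8"
    and pos: "0 < num_paths U E v (Suc j)"
  shows "(\<integral>\<^sup>+w. best_cost s \<theta> E U v (Suc j) w \<partial>(\<Pi>\<^sub>M e\<in>I. exp_measure))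
    \<le> ennreal (3 * exp (real j * (step_const * \<theta>\<^sup>2) - \<theta> * (log 2 (num_paths U E v (Suc j)) / 2)))"
proof (cases j)
  case 0
  have "ennreal 1 \<le> ennreal 3" by (rule ennreal_leI) simp
  with 0 show ?thesis using assms(4)
    by (simp add: nn_integral_best_cost_Suc_0 num_paths_def paths_from_Suc_0)
next
  case (Suc i)
  let ?n = "\<lambda>x. num_paths (U - {v}) E x (Suc i)"
  let ?F = "num_paths U E v (Suc (Suc i))"
  obtain y where y: "y \<in> nbrs E U v" and max: "\<And>x. x \<in> nbrs E U v \<Longrightarrow> ?n x \<le> ?n y" and ny: "0 < ?n y"
    using max_nbr_num_paths[OF assms(1,4) pos[unfolded Suc]] by blast
  have yU: "y \<in> U" using y by (simp add: nbrs_def)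
  have "?F \<le> card (nbrs E U v) * ?n y"
    unfolding num_paths_Suc_Suc[OF assms(1,4)]
    using sum_bounded_above[of "nbrs E U v" ?n "?n y"] max by simp
  also have "\<dots> \<le> 3 * ?n y" using deg[OF assms(4)] by (rule mult_right_mono) simp
  \<comment> \<open>Rounding 3 up to 4 makes the logarithm exactly 2.\<close>
  also have "\<dots> \<le> 4 * ?n y" by simp
  finally have F: "real ?F \<le> 4 * real (?n y)" by linarith
  have "log 2 ?F \<le> log 2 (4 * real (?n y))" using F pos Suc by simp
  also have "\<dots> = 2 + log 2 (?n y)"
    using ny log_pow_cancel[of 2 2] by (simp add: log_mult)
  finally have "\<theta> * (log 2 ?F / 2) \<le> \<theta> * (1 + log 2 (?n y) / 2)"
    using \<theta> by (intro mult_left_mono) auto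
  then have L: "- \<theta> * (log 2 (?n y) / 2) \<le> 1 - \<theta> * (log 2 ?F / 2)"
    using \<theta> by (simp add: algebra_simps)
  have "(\<integral>\<^sup>+w. best_cost s \<theta> E U v (Suc (Suc i)) w \<partial>(\<Pi>\<^sub>M e\<in>I. exp_measure)) \<le>
      ennreal (exp (step_const * \<theta>\<^sup>2)) * ennreal (exp (real i * (step_const * \<theta>\<^sup>2) - \<theta> * (log 2 (?n y) / 2)))"
  proof (intro nn_integral_best_cost_single[OF assms(1-4) y s \<theta>] nn_integral_best_cost s \<theta> ny)
    show "card (nbrs E (U - {v}) y) \<le> 2"
      using deg[OF yU] by (intro card_nbrs_Diff assms y) auto
    show "card (nbrs E (U - {v}) x) \<le> 3" if "x \<in> U - {v}" for x
    proof -
      have "card (nbrs E (U - {v}) x) \<le> card (nbrs E U x)"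
        using assms(1) by (intro card_mono) (auto simp: nbrs_def)
      then show ?thesis using deg[of x] that by auto
    qed
  qed (use assms y in \<open>auto simp: nbrs_def\<close>)
  also have "\<dots> = ennreal (exp (real (Suc i) * (step_const * \<theta>\<^sup>2) - \<theta> * (log 2 (?n y) / 2)))"
    by (simp add: ennreal_mult'[symmetric] algebra_simps flip: exp_add)
  \<comment> \<open>The loss \<open>\<theta>\<close> in the exponent is at most 1, and
    \<open>exp 1 \<le> 3\<close> yields the constant factor.\<close>
  also have "\<dots> \<le> ennreal (exp 1 * exp (real (Suc i) * (step_const * \<theta>\<^sup>2) - \<theta> * (log 2 ?F / 2)))"
    unfolding exp_add[symmetric] using L by (intro ennreal_leI) simp
  also have "\<dots> \<le> ennreal (3 * exp (real (Suc i) * (step_const * \<theta>\<^sup>2) - \<theta> * (log 2 ?F / 2)))"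
    by (intro ennreal_leI mult_right_mono exp_le) simp
  finally show ?thesis unfolding Suc .
qed

subsection \<open>Tail bounds\<close>

text \<open>Independence makes the joint law the product of the marginals, so the bounds on the
  product space carry over to the given weights.\<close>

lemma iid_exp_weights_distr:
  assumes iid: "iid_exp_weights M E W" and "E \<noteq> {}"
  shows "distr M (\<Pi>\<^sub>M e\<in>E. borel) (\<lambda>\<omega>. \<lambda>e\<in>E. W e \<omega>) = (\<Pi>\<^sub>M e\<in>E. exp_measure)"
proof -
  interpret prob_space M using iid by (simp add: iid_exp_weights_def)
  have dist: "distributed M lborel (W e) (exponential_density 1)" if "e \<in> E" for e
    using iid that by (simp add: iid_exp_weights_def)
  have rv: "random_variable borel (W e)" if "e \<in> E" for e
    using distributed_measurable[OF dist[OF that]] by simp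
  have "distr M (\<Pi>\<^sub>M e\<in>E. borel) (\<lambda>\<omega>. \<lambda>e\<in>E. W e \<omega>) = (\<Pi>\<^sub>M e\<in>E. distr M borel (W e))"
    using iid rv assms(2) by (subst indep_vars_iff_distr_eq_PiM'[symmetric]) (auto simp: iid_exp_weights_def)
  also have "\<dots> = (\<Pi>\<^sub>M e\<in>E. exp_measure)"
  proof (intro PiM_cong refl)
    fix e assume "e \<in> E"
    have "distr M borel (W e) = distr M lborel (W e)" by (rule distr_cong) auto
    also have "\<dots> = exp_measure"
      using distributed_distr_eq_density[OF dist[OF \<open>e \<in> E\<close>]] by (simp add: exp_measure_def)
    finally show "distr M borel (W e) = exp_measure" .
  qed
  finally show ?thesis .
qed

text \<open>A Chernoff bound: if every path is bad, the best cost is at least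
  \<open>exp (- \<theta> * (L - \<epsilon> * Suc j))\<close>, and Markov's inequality applies. The
  condition \<open>\<epsilon> \<le> step_const / 4\<close> amounts to
  \<open>\<theta> \<le> 1/8\<close>.\<close>

lemma prob_all_paths_bad:
  fixes \<epsilon> s :: real
  assumes graph: "simple_graph V E" and iid: "iid_exp_weights M E W" and E: "E \<noteq> {}"
    and u: "u \<in> V" and deg: "\<And>x. x \<in> V \<Longrightarrow> card (nbrs E V x) \<le> 3"
    and pos: "0 < num_paths V E u (Suc j)"
    and s: "s = 1 \<or> s = - 1" and \<epsilon>: "0 < \<epsilon>" "\<epsilon> \<le> step_const / 4"
  shows "measure M {\<omega> \<in> space M. \<forall>p\<in>paths_from V E u (Suc j).
      path_weight (\<lambda>e. s * (W e \<omega> - 1)) p < log 2 (num_paths V E u (Suc j)) / 2 - \<epsilon> * Suc j}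
    \<le> 3 * exp (- (\<epsilon>\<^sup>2 * Suc j / (4 * step_const)))"
    (is "measure M ?A \<le> _")
proof -
  interpret prob_space M using iid by (simp add: iid_exp_weights_def)
  \<comment> \<open>This \<open>\<theta>\<close> minimises the exponent \<open>(step_const * \<theta>\<^sup>2 - \<theta> * \<epsilon>) * k\<close>.\<close>
  define \<theta> where "\<theta> = \<epsilon> / (2 * step_const)"
  have \<theta>: "0 < \<theta>" "\<theta> \<le> 1/8" using \<epsilon> step_const_pos by (auto simp: \<theta>_def field_simps)
  define L where "L = log 2 (num_paths V E u (Suc j)) / 2"
  define c where "c = exp (\<theta> * (L - \<epsilon> * Suc j))"
  define X where "X \<omega> = (\<lambda>e\<in>E. W e \<omega>)" for \<omega>
  let ?b = "best_cost s \<theta> E V u (Suc j)"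
  have finV: "finite V" and EV: "\<And>e. e \<in> E \<Longrightarrow> e \<subseteq> V"
    using graph by (auto simp: simple_graph_def)
  have finE: "finite E" using EV by (intro finite_subset[of E "Pow V"]) (auto simp: finV)
  have rv: "W e \<in> borel_measurable M" if "e \<in> E" for e
    using iid that distributed_measurable[of M lborel "W e"] by (auto simp: iid_exp_weights_def)
  have X: "X \<in> M \<rightarrow>\<^sub>M (\<Pi>\<^sub>M e\<in>E. borel)"
    unfolding X_def by (intro measurable_restrict rv)
  have b [measurable]: "?b \<in> borel_measurable (\<Pi>\<^sub>M e\<in>E. exp_measure)"
    by (rule best_cost_measurable[OF finV])
  have b': "?b \<in> borel_measurable (\<Pi>\<^sub>M e\<in>E. borel)"
    using b by (simp cong: measurable_cong_sets sets_PiM_cong)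
  have bX [measurable]: "(\<lambda>\<omega>. ?b (X \<omega>)) \<in> borel_measurable M"
    by (rule measurable_compose[OF X b'])
  have "emeasure M ?A \<le> emeasure M {\<omega> \<in> space M. 1 \<le> ennreal c * ?b (X \<omega>)}"
  proof (intro emeasure_mono subsetI)
    fix \<omega> assume \<omega>: "\<omega> \<in> ?A"
    have "ennreal (exp (- \<theta> * (L - \<epsilon> * Suc j))) \<le> ?b (\<lambda>e. W e \<omega>)"
      unfolding best_cost_def L_def
      using \<omega> \<theta> by (intro INF_greatest ennreal_leI) (auto intro: less_imp_le)
    also have "?b (\<lambda>e. W e \<omega>) = ?b (X \<omega>)"
      by (rule best_cost_cong) (simp add: X_def)
    finally have "ennreal c * ennreal (exp (- \<theta> * (L - \<epsilon> * Suc j))) \<le> ennreal c * ?b (X \<omega>)"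
      by (rule mult_left_mono) simp
    then show "\<omega> \<in> {\<omega> \<in> space M. 1 \<le> ennreal c * ?b (X \<omega>)}"
      using \<omega> by (simp add: c_def ennreal_mult'[symmetric] flip: exp_add)
  qed measurable
  also have "\<dots> \<le> ennreal c * (\<integral>\<^sup>+\<omega>. ?b (X \<omega>) \<partial>M)"
    using nn_integral_Markov_inequality[of "\<lambda>\<omega>. ?b (X \<omega>)" "space M" M "ennreal c"]
    by (simp cong: nn_integral_cong)
  also have "(\<integral>\<^sup>+\<omega>. ?b (X \<omega>) \<partial>M) = (\<integral>\<^sup>+w. ?b w \<partial>(\<Pi>\<^sub>M e\<in>E. exp_measure))"
    unfolding iid_exp_weights_distr[OF iid E, symmetric] X_def[symmetric]
    using X b' by (simp add: nn_integral_distr)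
  also have "\<dots> \<le> ennreal (3 * exp (real j * (step_const * \<theta>\<^sup>2) - \<theta> * L))"
    unfolding L_def
    by (intro nn_integral_best_cost_root finV finE u deg s pos) (use \<theta> in auto)
  finally have "emeasure M ?A \<le> ennreal c * ennreal (3 * exp (real j * (step_const * \<theta>\<^sup>2) - \<theta> * L))"
    by (simp add: mult_left_mono)
  also have "\<dots> = ennreal (3 * exp (real j * (step_const * \<theta>\<^sup>2) - \<theta> * (\<epsilon> * Suc j)))"
    unfolding c_def by (simp add: ennreal_mult'[symmetric] algebra_simps flip: exp_add)
  also have "\<dots> \<le> ennreal (3 * exp (- (\<epsilon>\<^sup>2 * Suc j / (4 * step_const))))"
  proof (rule ennreal_leI)
    \<comment> \<open>A path has \<open>j\<close> edges; passing to the \<open>Suc j\<close>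
      vertices makes both terms of the exponent proportional to the same number.\<close>
    have "real j * (step_const * \<theta>\<^sup>2) \<le> real (Suc j) * (step_const * \<theta>\<^sup>2)"
      using step_const_pos by (intro mult_right_mono) auto
    moreover have "real (Suc j) * (step_const * \<theta>\<^sup>2) - \<theta> * (\<epsilon> * Suc j) = - (\<epsilon>\<^sup>2 * Suc j / (4 * step_const))"
      using step_const_pos unfolding \<theta>_def by (simp add: field_simps power2_eq_square)
    ultimately show "3 * exp (real j * (step_const * \<theta>\<^sup>2) - \<theta> * (\<epsilon> * Suc j)) \<le>
        3 * exp (- (\<epsilon>\<^sup>2 * Suc j / (4 * step_const)))" by simp
  qed
  finally show ?thesis
    by (simp add: emeasure_eq_measure)
qed

text \<open>Because \<open>3 ^ 5 = 243\<close> is below \<open>2 ^ 8 = 256\<close>. What matters is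
  a constant below 2: it keeps \<open>k - log 2 f / 2\<close> of order \<open>k\<close>, so that an
  error \<open>\<epsilon> * k\<close> is also small relative to it.\<close>

lemma log2_num_paths_le:
  assumes "finite V" "u \<in> V" "\<And>x. x \<in> V \<Longrightarrow> card (nbrs E V x) \<le> 3"
    and pos: "0 < num_paths V E u (Suc j)"
  shows "log 2 (num_paths V E u (Suc j)) \<le> 8 / 5 * j"
proof -
  have "5 * log 2 3 = log 2 ((3::real) ^ 5)" by (subst log_nat_power) auto
  also have "\<dots> \<le> log 2 (2 ^ 8)" by simp
  also have "\<dots> = (8::real)" by (subst log_pow_cancel) auto
  finally have log3: "log 2 3 \<le> 8 / (5::real)" by simp
  have "real (num_paths V E u (Suc j)) \<le> 3 ^ j"
    using num_paths_le_power[OF assms(1-3), of j] by (metis of_nat_le_iff of_nat_numeral of_nat_power)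
  then have "log 2 (num_paths V E u (Suc j)) \<le> log 2 (3 ^ j)" using pos by simp
  also have "\<dots> = j * log 2 3" by (rule log_nat_power) simp
  also have "\<dots> \<le> j * (8 / 5)" by (rule mult_left_mono[OF log3]) simp
  finally show ?thesis by (simp add: mult.commute)
qed

text \<open>Union bound over both signs. In \<open>\<delta>\<close>, the 5 answers to
  \<open>k - L \<ge> k / 5\<close> in the upper bound, and \<open>1 / k\<close> to the lower bound,
  where a path of \<open>k\<close> vertices has only \<open>k - 1\<close> edges.\<close>

lemma prob_good_paths:
  fixes \<epsilon> :: real
  assumes graph: "simple_graph V E" and iid: "iid_exp_weights M E W" and E: "E \<noteq> {}"
    and u: "u \<in> V" and deg: "\<And>x. x \<in> V \<Longrightarrow> card (nbrs E V x) \<le> 3"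
    and k: "0 < k" and pos: "0 < num_paths V E u k"
    and \<epsilon>: "0 < \<epsilon>" "\<epsilon> \<le> step_const / 4"
  defines "L \<equiv> log 2 (real (num_paths V E u k)) / 2" and "\<delta> \<equiv> 5 * \<epsilon> + 1 / k"
  shows "\<P>(\<omega> in M.
      (\<exists>p \<in> paths_from V E u k. path_weight (\<lambda>e. W e \<omega>) p \<ge> (1 - \<delta>) * (k + L)) \<and>
      (\<exists>p \<in> paths_from V E u k. path_weight (\<lambda>e. W e \<omega>) p \<le> (1 + \<delta>) * (k - L)))
    \<ge> 1 - 6 * exp (- (\<epsilon>\<^sup>2 * k / (4 * step_const)))"
    (is "measure M ?G \<ge> _")
proof -
  interpret prob_space M using iid by (simp add: iid_exp_weights_def)
  obtain j where j: "k = Suc j" using k by (cases k) auto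
  define A where "A s = {\<omega> \<in> space M. \<forall>p\<in>paths_from V E u k.
      path_weight (\<lambda>e. s * (W e \<omega> - 1)) p < L - \<epsilon> * k}" for s
  have finV: "finite V" using graph by (simp add: simple_graph_def)
  have fin: "finite (paths_from V E u k)" by (rule finite_paths_from[OF finV])
  have rv: "W e \<in> borel_measurable M" if "e \<in> E" for e
    using iid that distributed_measurable[of M lborel "W e"] by (auto simp: iid_exp_weights_def)
  have [measurable]: "(\<lambda>\<omega>. path_weight (\<lambda>e. W e \<omega>) p) \<in> borel_measurable M"
    if "p \<in> paths_from V E u k" for p
    using that by (intro path_weight_measurable[of V E] rv) (auto simp: paths_from_def)
  have A: "A s \<in> events" for s
    unfolding A_def path_weight_centered by (measurable, use fin in \<open>auto intro: countable_finite\<close>)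
  have G: "?G \<in> events"
    by (measurable, use fin in \<open>auto intro: countable_finite\<close>)
  have prob_A: "prob (A s) \<le> 3 * exp (- (\<epsilon>\<^sup>2 * k / (4 * step_const)))" if "s = 1 \<or> s = - 1" for s
    using prob_all_paths_bad[OF graph iid E u deg pos[unfolded j] that \<epsilon>]
    unfolding A_def L_def j by simp
  have L0: "0 \<le> L" using pos by (simp add: L_def)
  have L1: "L \<le> 4 / 5 * k"
    using log2_num_paths_le[OF finV u deg pos[unfolded j]] by (simp add: L_def j)
  have len: "length p = k" if "p \<in> paths_from V E u k" for p
    using that by (simp add: paths_from_def)
  have k1: "real (k - 1) = real k - 1" using j by simp
  have \<delta>k: "\<delta> * k = 5 * (\<epsilon> * k) + 1" and \<delta>0: "0 \<le> \<delta>"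
    using k \<epsilon> by (auto simp: \<delta>_def field_simps)
  have "space M - (A 1 \<union> A (- 1)) \<subseteq> ?G"
  proof
    fix \<omega> assume "\<omega> \<in> space M - (A 1 \<union> A (- 1))"
    then obtain p q where \<omega>: "\<omega> \<in> space M"
      and p: "p \<in> paths_from V E u k" "L - \<epsilon> * k \<le> path_weight (\<lambda>e. W e \<omega>) p - real (k - 1)"
      and q: "q \<in> paths_from V E u k" "L - \<epsilon> * k \<le> - (path_weight (\<lambda>e. W e \<omega>) q - real (k - 1))"
      unfolding A_def path_weight_centered by (auto simp: not_less len)
    \<comment> \<open>The relative error is worth at least
      \<open>\<delta> * k = 5 * (\<epsilon> * k) + 1\<close>, which covers the fluctuation
      \<open>\<epsilon> * k\<close> and the missing edge.\<close>
    have "(1 - \<delta>) * (k + L) \<le> k + L - \<delta> * k"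
      using mult_nonneg_nonneg[OF \<delta>0 L0] by (simp add: algebra_simps)
    moreover have "0 \<le> \<epsilon> * k" using \<epsilon> by simp
    ultimately have "(1 - \<delta>) * (k + L) \<le> path_weight (\<lambda>e. W e \<omega>) p"
      using p(2) \<delta>k k1 by linarith
    moreover have "path_weight (\<lambda>e. W e \<omega>) q \<le> (1 + \<delta>) * (k - L)"
    proof -
      have "\<delta> * k / 5 \<le> \<delta> * (k - L)"
        using mult_left_mono[OF _ \<delta>0, of "k / 5" "k - L"] L1 by simp
      moreover have "(1 + \<delta>) * (k - L) = k - L + \<delta> * (k - L)" by (simp add: algebra_simps)
      ultimately show ?thesis using q(2) \<delta>k k1 by linarith
    qed
    ultimately show "\<omega> \<in> ?G" using \<omega> p(1) q(1) by blast
  qed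
  then have "prob (space M - (A 1 \<union> A (- 1))) \<le> prob ?G"
    using G by (rule finite_measure_mono)
  moreover have "prob (space M - (A 1 \<union> A (- 1))) = 1 - prob (A 1 \<union> A (- 1))"
    using A by (intro prob_compl) auto
  moreover have "prob (A 1 \<union> A (- 1)) \<le> prob (A 1) + prob (A (- 1))"
    using A by (intro measure_Un_le) auto
  ultimately show ?thesis using prob_A[of 1] prob_A[of "- 1"] by simp
qed

section \<open>Passage to the limit\<close>

theorem theorem2:
  fixes N :: "nat set"
    and V :: "nat \<Rightarrow> 'v set"
    and E :: "nat \<Rightarrow> 'v set set"
    and k :: "nat \<Rightarrow> nat"
    and u0 :: "nat \<Rightarrow> 'v"
    and M :: "nat \<Rightarrow> 'w measure"
    and W :: "nat \<Rightarrow> 'v set \<Rightarrow> 'w \<Rightarrow> real"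
  assumes N_infinite: "infinite N"
    and N_pos: "\<And>n. n \<in> N \<Longrightarrow> 0 < n"
    and graph: "\<And>n. n \<in> N \<Longrightarrow> simple_graph (V n) (E n)"
    and card_V: "\<And>n. n \<in> N \<Longrightarrow> card (V n) = n"
    and max_deg: "\<And>n. n \<in> N \<Longrightarrow> max_degree (V n) (E n) \<le> 3"
    and k_pos: "\<And>n. n \<in> N \<Longrightarrow> 0 < k n"
    and k_le: "\<And>n. n \<in> N \<Longrightarrow> k n \<le> n"
    and k_large: "filterlim (\<lambda>n. real (k n) / sqrt (real n)) at_top (at_top_in N)"
    and u0: "\<And>n. n \<in> N \<Longrightarrow> u0 n \<in> V n"
    and f_large: "filterlim (\<lambda>n. num_paths (V n) (E n) (u0 n) (k n)) at_top (at_top_in N)"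
    and weights: "\<And>n. n \<in> N \<Longrightarrow> iid_exp_weights (M n) (E n) (W n)"
  shows "\<exists>\<delta> :: nat \<Rightarrow> real.
    (\<delta> \<longlongrightarrow> 0) (at_top_in N) \<and>
    ((\<lambda>n. \<P>(\<omega> in M n.
        (\<exists>p \<in> paths_from (V n) (E n) (u0 n) (k n).
           path_weight (\<lambda>e. W n e \<omega>) p \<ge>
             (1 - \<delta> n) *
             (real (k n) + log 2 (real (num_paths (V n) (E n) (u0 n) (k n))) / 2)) \<and>
        (\<exists>p \<in> paths_from (V n) (E n) (u0 n) (k n).
           path_weight (\<lambda>e. W n e \<omega>) p \<le>
             (1 + \<delta> n) *
             (real (k n) - log 2 (real (num_paths (V n) (E n) (u0 n) (k n))) / 2))))
      \<longlongrightarrow> 1) (at_top_in N)"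
proof -
  \<comment> \<open>The exponent makes \<open>\<epsilon>\<close> vanish while
    \<open>(\<epsilon> k)\<^sup>2 * k = sqrt k\<close> still tends to infinity, so the failure
    probability vanishes too.\<close>
  define \<epsilon> where "\<epsilon> x = x powr (- 1 / 4)" for x :: real
  define \<delta> where "\<delta> n = 5 * \<epsilon> (k n) + 1 / k n" for n
  have in_N: "\<forall>\<^sub>F n in at_top_in N. n \<in> N"
    by (auto simp: at_top_in_def eventually_inf_principal)
  have k_lim: "filterlim (\<lambda>n. real (k n)) at_top (at_top_in N)"
  proof (rule filterlim_at_top_mono[OF k_large])
    show "\<forall>\<^sub>F n in at_top_in N. real (k n) / sqrt (real n) \<le> real (k n)"
      using in_N
    proof eventually_elim
      case (elim n)
      then have "1 \<le> sqrt (real n)" using N_pos[of n] by simp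
      then show ?case using divide_left_mono[of 1 "sqrt (real n)" "real (k n)"] by simp
    qed
  qed
  have \<epsilon>_lim: "(\<epsilon> \<longlongrightarrow> 0) at_top" unfolding \<epsilon>_def by real_asymp
  have "((\<lambda>x. 5 * \<epsilon> x + 1 / x) \<longlongrightarrow> 0) at_top" unfolding \<epsilon>_def by real_asymp
  from filterlim_compose[OF this k_lim] have \<delta>_lim: "(\<delta> \<longlongrightarrow> 0) (at_top_in N)"
    by (simp add: \<delta>_def[abs_def])
  have "((\<lambda>x. 1 - 6 * exp (- ((\<epsilon> x)\<^sup>2 * x / (4 * step_const)))) \<longlongrightarrow> 1) at_top"
    unfolding \<epsilon>_def using step_const_pos by real_asymp
  note lower_lim = filterlim_compose[OF this k_lim]
  have "\<forall>\<^sub>F x in at_top. \<epsilon> x < step_const / 4"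
    using \<epsilon>_lim step_const_pos by (intro order_tendstoD) auto
  then have \<epsilon>_small: "\<forall>\<^sub>F n in at_top_in N. \<epsilon> (k n) < step_const / 4"
    using k_lim by (rule eventually_compose_filterlim)
  \<comment> \<open>A path with two vertices has an edge, which makes \<open>E n\<close> nonempty as
    \<open>prob_good_paths\<close> requires.\<close>
  have k2: "\<forall>\<^sub>F n in at_top_in N. 2 \<le> real (k n)"
    using k_lim unfolding filterlim_at_top by blast
  have f1: "\<forall>\<^sub>F n in at_top_in N. 1 \<le> num_paths (V n) (E n) (u0 n) (k n)"
    using f_large by (simp add: filterlim_at_top)
  let ?P = "\<lambda>n. \<P>(\<omega> in M n.
        (\<exists>p \<in> paths_from (V n) (E n) (u0 n) (k n).
           path_weight (\<lambda>e. W n e \<omega>) p \<ge>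
             (1 - \<delta> n) *
             (real (k n) + log 2 (real (num_paths (V n) (E n) (u0 n) (k n))) / 2)) \<and>
        (\<exists>p \<in> paths_from (V n) (E n) (u0 n) (k n).
           path_weight (\<lambda>e. W n e \<omega>) p \<le>
             (1 + \<delta> n) *
             (real (k n) - log 2 (real (num_paths (V n) (E n) (u0 n) (k n))) / 2)))"
  have lower: "\<forall>\<^sub>F n in at_top_in N. 1 - 6 * exp (- ((\<epsilon> (k n))\<^sup>2 * k n / (4 * step_const))) \<le> ?P n"
    using in_N \<epsilon>_small k2 f1
  proof eventually_elim
    case (elim n)
    have fin: "finite (V n)" using graph[OF elim(1)] by (simp add: simple_graph_def)
    have deg: "card (nbrs (E n) (V n) x) \<le> 3" if "x \<in> V n" for x
    proof -
      have "degree (E n) x \<le> max_degree (V n) (E n)"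
        unfolding max_degree_def using fin that by (intro Max_ge) auto
      then show ?thesis
        using card_nbrs_le_degree[OF graph[OF elim(1)], of x] max_deg[OF elim(1)] by linarith
    qed
    obtain p where p: "p \<in> paths_from (V n) (E n) (u0 n) (k n)"
      using elim(4) unfolding num_paths_def by (metis card.empty equals0I not_one_le_zero)
    then have "E n \<noteq> {}"
      using path_edge(1)[of "V n" "E n" p 0] elim(3) by (auto simp: paths_from_def)
    moreover have "0 < \<epsilon> (k n)" using elim(3) by (simp add: \<epsilon>_def)
    ultimately show ?case
      unfolding \<delta>_def using elim
      by (intro prob_good_paths graph weights u0 deg k_pos) auto
  qed
  have upper: "\<forall>\<^sub>F n in at_top_in N. ?P n \<le> 1"
    using in_N
  proof eventually_elim
    case (elim n)
    then interpret prob_space "M n" using weights[of n] by (simp add: iid_exp_weights_def)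
    show ?case by (rule prob_le_1)
  qed
  have "(?P \<longlongrightarrow> 1) (at_top_in N)"
    by (rule tendsto_sandwich[OF lower upper lower_lim tendsto_const])
  with \<delta>_lim show ?thesis by blast
qed

end
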